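(* There exist universal constants $c,C,\bar c,\tilde c,\tilde C,c_1,C_1,c''>0$ such that the following holds. Let $Y=\sum_{i=1}^ku_iZ_i^2$, where $u_1,\dots,u_k$ are fixed non-negative values, not all zero, and $Z_1,\dots,Z_k$ are i.i.d. $N(0,1)$. Then $X=Y-\sum_{i=1}^ku_i$ satisfies $$c\exp\left(-Cx^2/\|u\|_2^2\right)\le\mathbb{P}(X\ge x)\le\exp\left(-\bar cx^2/\|u\|_2^2\right),\qquad\forall\,0\le x\le\frac{\|u\|_2^2}{\|u\|_\infty};$$ $$\tilde c\exp\left(-\tilde Cx/\|u\|_\infty\right)\le\mathbb{P}(X\ge x)\le\exp\left(-\bar cx/\|u\|_\infty\right),\qquad\forall\,x>\frac{\|u\|_2^2}{\|u\|_\infty};$$ $$c_1\exp\left(-C_1x^2/\|u\|_2^2\right)\le\mathbb{P}(X\le-x)\le\exp\left(-\tfrac14x^2/\|u\|_2^2\right),\qquad\forall\,0\le x\le c''\frac{\|u\|_2^2}{\|u\|_\infty}.$$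
   Context: For $u\in\mathbb{R}^k$, $\|u\|_2=(\sum_iu_i^2)^{1/2}$ and $\|u\|_\infty=\max_i|u_i|$. *)

theory Defs
  imports "HOL-Probability.Probability"
begin

definition iid_std_normal :: "'a measure \<Rightarrow> nat \<Rightarrow> (nat \<Rightarrow> 'a \<Rightarrow> real) \<Rightarrow> bool" where
  "iid_std_normal M k Z \<longleftrightarrow>
     prob_space M \<and>
     prob_space.indep_vars M (\<lambda>_. borel) Z {1..k} \<and>
     (\<forall>i\<in>{1..k}. distributed M lborel (Z i) (\<lambda>x. ennreal (std_normal_density x)))"

definition norm_inf :: "nat \<Rightarrow> (nat \<Rightarrow> real) \<Rightarrow> real" where
  \<comment> \<open>Only meaningful for \<open>k \<ge> 1\<close>. The Euclidean norm is \<open>L2_set u {1..k}\<close>.\<close>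
  "norm_inf k u = Max ((\<lambda>i. \<bar>u i\<bar>) ` {1..k})"

definition centered_weighted_chi_square ::
    "nat \<Rightarrow> (nat \<Rightarrow> real) \<Rightarrow> (nat \<Rightarrow> 'a \<Rightarrow> real) \<Rightarrow> 'a \<Rightarrow> real" where
  "centered_weighted_chi_square k u Z \<omega> = (\<Sum>i=1..k. u i * (Z i \<omega>)\<^sup>2) - (\<Sum>i=1..k. u i)"

text \<open>
  The tail bounds, with given constants, for all dimensions, all weights and all probability spaces
  whose sample space is (a subset of) the type \<open>'a\<close>. The sample type is an explicit parameter because
  HOL cannot quantify over types inside a formula, so that ``there are constants such that for
  every probability space'' has to be split into an existence claim at one type and a transfer
  claim from that type to all others.
\<close>

definition chi_square_tail_bounds ::
    "'a itself \<Rightarrow> real \<Rightarrow> real \<Rightarrow> real \<Rightarrow> real \<Rightarrow> real \<Rightarrow> real \<Rightarrow> real \<Rightarrow> real \<Rightarrow> bool" where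
  "chi_square_tail_bounds TYPE('a) c C cbar ctilde Ctilde c1 C1 c2 \<longleftrightarrow>
    (\<forall>(k::nat) (u :: nat \<Rightarrow> real) (M :: 'a measure) (Z :: nat \<Rightarrow> 'a \<Rightarrow> real).
      (\<forall>i\<in>{1..k}. 0 \<le> u i) \<longrightarrow> (\<exists>i\<in>{1..k}. u i \<noteq> 0) \<longrightarrow> iid_std_normal M k Z \<longrightarrow>
      (let X = centered_weighted_chi_square k u Z;
           n2 = L2_set u {1..k};
           ninf = norm_inf k u
       in
        (\<forall>x. 0 \<le> x \<and> x \<le> n2\<^sup>2 / ninf \<longrightarrow>
           c * exp (- C * x\<^sup>2 / n2\<^sup>2) \<le> measure M {\<omega> \<in> space M. X \<omega> \<ge> x} \<and>
           measure M {\<omega> \<in> space M. X \<omega> \<ge> x} \<le> exp (- cbar * x\<^sup>2 / n2\<^sup>2)) \<and>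
        (\<forall>x. x > n2\<^sup>2 / ninf \<longrightarrow>
           ctilde * exp (- Ctilde * x / ninf) \<le> measure M {\<omega> \<in> space M. X \<omega> \<ge> x} \<and>
           measure M {\<omega> \<in> space M. X \<omega> \<ge> x} \<le> exp (- cbar * x / ninf)) \<and>
        (\<forall>x. 0 \<le> x \<and> x \<le> c2 * (n2\<^sup>2 / ninf) \<longrightarrow>
           c1 * exp (- C1 * x\<^sup>2 / n2\<^sup>2) \<le> measure M {\<omega> \<in> space M. X \<omega> \<le> - x} \<and>
           measure M {\<omega> \<in> space M. X \<omega> \<le> - x} \<le> exp (- (1/4) * x\<^sup>2 / n2\<^sup>2))))"

end

theory Submission
  imports Defs
begin

text \<open>
  Write \<open>X = \<Sum>\<^sub>i u\<^sub>i (Z\<^sub>i\<^sup>2 - 1)\<close>, \<open>V = \<Sum>\<^sub>i u\<^sub>i\<^sup>2\<close> and \<open>m = max\<^sub>i u\<^sub>i\<close>. Everything rests on the exact formula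
  \<open>E exp (t X) = exp (\<Sum>\<^sub>i (- ln (1 - 2 t u\<^sub>i) - 2 t u\<^sub>i) / 2)\<close> (\<open>mgf_X\<close>). Since \<open>- ln (1 - s) - s\<close>
  lies between constant multiples of \<open>s\<^sup>2\<close> for small \<open>s\<close>, the logarithm of the generating function
  lies between multiples of \<open>t\<^sup>2 V\<close> as long as \<open>t m\<close> is small.

  The upper bounds for the tails follow by Chernoff's method. For the upper tail, the optimal \<open>t\<close> is
  of order \<open>x / V\<close>; it is admissible up to \<open>x = V / m\<close>, and beyond that \<open>t\<close> of order \<open>1 / m\<close>
  yields the exponential decay. The lower tail uses negative \<open>t\<close>, for which no restriction is needed.

  The lower bounds combine two mechanisms. For \<open>x \<le> V / (64 m)\<close>, many coordinates may have to
  cooperate. Here the Paley--Zygmund inequality for \<open>exp (t X)\<close> shows that \<open>t X \<ge> t\<^sup>2 V / 4\<close> with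
  probability at least a multiple of \<open>exp (- 7 t\<^sup>2 V)\<close>, for \<open>t\<close> of either sign with \<open>t\<^sup>2 V\<close> bounded
  away from \<open>0\<close> (\<open>two_sided_tail_ge\<close>, \<open>tails_ge_gaussian\<close>). For larger \<open>x\<close>, the coordinate with the largest
  weight reaches the level on its own, while the rest, independent of it, is unlikely to fall below
  \<open>- 2 sqrt V\<close> (\<open>upper_tail_ge_exponential\<close>).

  The bounds hold for all sample types by the same proof (\<open>chi_square_tail_bounds_explicit\<close>). The
  transfer of arbitrary constants from functions \<open>nat \<Rightarrow> real\<close> to another sample type is a
  different matter: it holds because the probabilities depend only on the joint law of the \<open>Z\<^sub>i\<close>, a
  measure on such functions (\<open>iid_std_normal_pushforward\<close>, \<open>chi_square_tail_bounds_transfer\<close>).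
\<close>

section \<open>Quadratic bounds for the logarithm\<close>

text \<open>
  The difference vanishes at \<open>0\<close> and its derivative is \<open>x * (1 / (1 - x) - 2 * a)\<close>, so this is
  the mean value theorem. As \<open>s\<close> and \<open>\<xi>\<close> have the same sign, the sign of the difference is that
  of \<open>1 / (1 - \<xi>) - 2 * a\<close>; each of the three quadratic bounds below reads it off for one \<open>a\<close>.
\<close>

lemma minus_ln_one_minus_remainder:
  fixes a s :: real
  assumes "s < 1"
  obtains \<xi> where "\<xi> \<in> closed_segment 0 s" "0 \<le> s * \<xi>"
    "- ln (1 - s) - s - a * s\<^sup>2 = s * \<xi> * (1 / (1 - \<xi>) - 2 * a)"
proof -
  define f where "f x = - ln (1 - x) - x - a * x\<^sup>2" for x :: real
  have deriv: "(f has_real_derivative x * (1 / (1 - x) - 2 * a)) (at x)" if "x < 1" for x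
  proof -
    have "(f has_real_derivative - ((0 - 1) / (1 - x)) - 1 - a * (2 * x)) (at x)"
      unfolding f_def using that by (auto intro!: derivative_eq_intros)
    also have "- ((0 - 1) / (1 - x)) - 1 - a * (2 * x) = x * (1 / (1 - x) - 2 * a)"
      using that by (simp add: field_simps)
    finally show ?thesis .
  qed
  have f0: "f 0 = 0"
    by (simp add: f_def)
  consider "s = 0" | "0 < s" | "s < 0"
    by linarith
  then have "\<exists>\<xi>\<in>closed_segment 0 s. 0 \<le> s * \<xi> \<and> f s = s * \<xi> * (1 / (1 - \<xi>) - 2 * a)"
  proof cases
    case 1
    then show ?thesis by (auto simp: f0)
  next
    case 2
    obtain z where "0 < z" "z < s" "f s - f 0 = (s - 0) * (z * (1 / (1 - z) - 2 * a))"
      using MVT2[of 0 s f "\<lambda>x. x * (1 / (1 - x) - 2 * a)"] deriv assms 2 by force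
    with 2 f0 show ?thesis
      by (intro bexI[of _ z]) (auto simp: closed_segment_eq_real_ivl)
  next
    case 3
    obtain z where "s < z" "z < 0" "f 0 - f s = (0 - s) * (z * (1 / (1 - z) - 2 * a))"
      using MVT2[of s 0 f "\<lambda>x. x * (1 / (1 - x) - 2 * a)"] deriv 3 by force
    with 3 f0 show ?thesis
      by (intro bexI[of _ z]) (auto simp: closed_segment_eq_real_ivl mult_nonpos_nonpos)
  qed
  with that show thesis
    unfolding f_def by blast
qed

lemma minus_ln_one_minus_ge:
  fixes s :: real
  assumes "- 1 \<le> s" "s < 1"
  shows "s\<^sup>2 / 4 \<le> - ln (1 - s) - s"
proof -
  obtain \<xi> where \<xi>: "\<xi> \<in> closed_segment 0 s" "0 \<le> s * \<xi>"
    "- ln (1 - s) - s - 1 / 4 * s\<^sup>2 = s * \<xi> * (1 / (1 - \<xi>) - 2 * (1 / 4))"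
    by (rule minus_ln_one_minus_remainder[OF assms(2)])
  have "- 1 \<le> \<xi>" "\<xi> < 1"
    using \<xi>(1) assms by (auto simp: closed_segment_eq_real_ivl split: if_splits)
  then have "0 \<le> 1 / (1 - \<xi>) - 2 * (1 / 4)"
    by (simp add: field_simps)
  from mult_nonneg_nonneg[OF \<xi>(2) this] show ?thesis
    unfolding \<xi>(3)[symmetric] by simp
qed

lemma minus_ln_one_minus_le:
  fixes s :: real
  assumes "s \<le> 1 / 2"
  shows "- ln (1 - s) - s \<le> s\<^sup>2"
proof -
  have "s < 1"
    using assms by simp
  obtain \<xi> where \<xi>: "\<xi> \<in> closed_segment 0 s" "0 \<le> s * \<xi>"
    "- ln (1 - s) - s - 1 * s\<^sup>2 = s * \<xi> * (1 / (1 - \<xi>) - 2 * 1)"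
    by (rule minus_ln_one_minus_remainder[OF \<open>s < 1\<close>])
  have "\<xi> \<le> 1 / 2"
    using \<xi>(1) assms by (auto simp: closed_segment_eq_real_ivl split: if_splits)
  then have "1 / (1 - \<xi>) - 2 * 1 \<le> 0"
    by (simp add: field_simps)
  from mult_nonneg_nonpos[OF \<xi>(2) this] show ?thesis
    unfolding \<xi>(3)[symmetric] by simp
qed

text \<open>
  For negative arguments the Taylor coefficient \<open>1/2\<close> itself is an upper bound. This is what gives
  the lower tail the sharp exponent \<open>x\<^sup>2 / (4 V)\<close>.
\<close>

lemma minus_ln_one_minus_le_half:
  fixes s :: real
  assumes "s \<le> 0"
  shows "- ln (1 - s) - s \<le> s\<^sup>2 / 2"
proof -
  have "s < 1"
    using assms by simp
  obtain \<xi> where \<xi>: "\<xi> \<in> closed_segment 0 s" "0 \<le> s * \<xi>"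
    "- ln (1 - s) - s - 1 / 2 * s\<^sup>2 = s * \<xi> * (1 / (1 - \<xi>) - 2 * (1 / 2))"
    by (rule minus_ln_one_minus_remainder[OF \<open>s < 1\<close>])
  have "\<xi> \<le> 0"
    using \<xi>(1) assms by (auto simp: closed_segment_eq_real_ivl split: if_splits)
  then have "1 / (1 - \<xi>) - 2 * (1 / 2) \<le> 0"
    by (simp add: field_simps)
  from mult_nonneg_nonpos[OF \<xi>(2) this] show ?thesis
    unfolding \<xi>(3)[symmetric] by simp
qed

section \<open>Two tail inequalities\<close>

text \<open>
  For every \<open>l \<ge> 0\<close> the indicator of the event dominates \<open>2 l (W - \<theta> a) - l\<^sup>2 W\<^sup>2\<close> pointwise: where
  \<open>W < \<theta> a\<close> this is not positive, and elsewhere it is at most \<open>2 l W - (l W)\<^sup>2 \<le> 1\<close>. Integrate,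
  replace the two moments by their bounds \<open>a\<close> and \<open>b\<close>, and take the optimal \<open>l\<close>. The pointwise
  bound does the work of the Cauchy--Schwarz inequality in the usual argument.
\<close>

lemma (in prob_space) Paley_Zygmund:
  fixes W :: "'a \<Rightarrow> real"
  assumes "integrable M W" "integrable M (\<lambda>\<omega>. (W \<omega>)\<^sup>2)"
    and "0 \<le> a" "a \<le> expectation W" "expectation (\<lambda>\<omega>. (W \<omega>)\<^sup>2) \<le> b" "0 < b"
    and "0 \<le> \<theta>" "\<theta> \<le> 1"
  shows "(1 - \<theta>)\<^sup>2 * a\<^sup>2 / b \<le> prob {\<omega> \<in> space M. \<theta> * a \<le> W \<omega>}"
proof -
  note assms(1,2)[measurable]
  define A where "A = {\<omega> \<in> space M. \<theta> * a \<le> W \<omega>}"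
  have [measurable]: "A \<in> events"
    using assms(1) unfolding A_def by measurable
  \<comment> \<open>the maximizer of \<open>2 l (1 - \<theta>) a - l\<^sup>2 b\<close>\<close>
  define l where "l = (1 - \<theta>) * a / b"
  have l: "0 \<le> l"
    using assms by (simp add: l_def)
  have "l * b = (1 - \<theta>) * a"
    using \<open>0 < b\<close> by (simp add: l_def)
  moreover have "(1 - \<theta>)\<^sup>2 * a\<^sup>2 / b = l * ((1 - \<theta>) * a)"
    by (simp add: l_def power2_eq_square mult_ac)
  ultimately have "(1 - \<theta>)\<^sup>2 * a\<^sup>2 / b = 2 * l * (a - \<theta> * a) - l\<^sup>2 * b"
    by (simp add: power2_eq_square mult.assoc) (simp add: algebra_simps)
  also have "\<dots> \<le> 2 * l * (expectation W - \<theta> * a) - l\<^sup>2 * expectation (\<lambda>\<omega>. (W \<omega>)\<^sup>2)"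
    using assms l by (intro diff_mono mult_left_mono) auto
  also have "\<dots> = expectation (\<lambda>\<omega>. 2 * l * (W \<omega> - \<theta> * a) - l\<^sup>2 * (W \<omega>)\<^sup>2)"
    using assms by (simp add: prob_space)
  also have "\<dots> \<le> expectation (indicator A)"
  proof (rule integral_mono)
    fix \<omega> assume "\<omega> \<in> space M"
    show "2 * l * (W \<omega> - \<theta> * a) - l\<^sup>2 * (W \<omega>)\<^sup>2 \<le> indicator A \<omega>"
    proof (cases "\<omega> \<in> A")
      case True
      have "0 \<le> (1 - l * W \<omega>)\<^sup>2" "0 \<le> l * (\<theta> * a)"
        using l assms by auto
      with True show ?thesis
        by (simp add: power2_eq_square algebra_simps)
    next
      case False
      then have "l * (W \<omega> - \<theta> * a) \<le> 0"
        using l \<open>\<omega> \<in> space M\<close> by (intro mult_nonneg_nonpos) (auto simp: A_def)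
      moreover have "0 \<le> l\<^sup>2 * (W \<omega>)\<^sup>2"
        by simp
      ultimately show ?thesis
        unfolding indicator_simps(2)[OF False] mult.assoc by linarith
    qed
  next
    show "integrable M (indicator A :: 'a \<Rightarrow> real)"
      by (rule integrable_real_indicator) (simp_all add: emeasure_eq_measure)
  qed (use assms in auto)
  also have "\<dots> = prob A"
    by simp
  finally show ?thesis
    unfolding A_def .
qed

text \<open>
  The parameter \<open>t\<close> may have either sign, so that the inequality covers both tails.
\<close>

lemma (in prob_space) Chernoff:
  fixes X :: "'a \<Rightarrow> real"
  assumes "integrable M (\<lambda>\<omega>. exp (t * X \<omega>))"
  shows "prob {\<omega> \<in> space M. y \<le> t * X \<omega>} \<le> exp (- y) * expectation (\<lambda>\<omega>. exp (t * X \<omega>))"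
proof -
  have "prob {\<omega> \<in> space M. exp y \<le> exp (t * X \<omega>)} \<le> expectation (\<lambda>\<omega>. exp (t * X \<omega>)) / exp y"
    by (rule integral_Markov_inequality_measure[OF assms, of "{}"]) auto
  then show ?thesis
    by (simp add: exp_minus field_simps)
qed

section \<open>The square of a standard normal variable\<close>

text \<open>
  The integrand is a multiple of the centered normal density with variance \<open>1 / (1 - 2 t)\<close>.
\<close>

lemma has_bochner_integral_exp_square_std_normal:
  fixes t :: real
  assumes "t < 1 / 2"
  shows "has_bochner_integral lborel (\<lambda>x. std_normal_density x * exp (t * x\<^sup>2)) (1 / sqrt (1 - 2 * t))"
proof -
  define \<sigma> where "\<sigma> = 1 / sqrt (1 - 2 * t)"
  have \<sigma>: "\<sigma> > 0" "\<sigma>\<^sup>2 = 1 / (1 - 2 * t)"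
    using assms by (simp_all add: \<sigma>_def power_divide)
  have eq: "std_normal_density x * exp (t * x\<^sup>2) = \<sigma> * normal_density 0 \<sigma> x" for x
  proof -
    have "- x\<^sup>2 / 2 + t * x\<^sup>2 = - x\<^sup>2 / (2 * \<sigma>\<^sup>2)"
      using assms by (simp add: \<sigma> field_simps)
    then have "exp (- x\<^sup>2 / 2) * exp (t * x\<^sup>2) = exp (- x\<^sup>2 / (2 * \<sigma>\<^sup>2))"
      by (simp flip: exp_add)
    then show ?thesis
      using \<sigma>(1) by (simp add: std_normal_density_def normal_density_def real_sqrt_mult)
  qed
  have "has_bochner_integral lborel (normal_density 0 \<sigma>) 1"
    using \<sigma>(1) by (simp add: has_bochner_integral_iff)
  from has_bochner_integral_mult_right[OF this, of \<sigma>]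
  have "has_bochner_integral lborel (\<lambda>x. \<sigma> * normal_density 0 \<sigma> x) \<sigma>" by simp
  then show ?thesis
    unfolding eq by (simp add: \<sigma>_def)
qed

lemma (in prob_space) mgf_centered_std_normal_square:
  assumes Z: "distributed M lborel Z (\<lambda>x. ennreal (std_normal_density x))" and t: "t < 1 / 2"
  shows "has_bochner_integral M (\<lambda>\<omega>. exp (t * ((Z \<omega>)\<^sup>2 - 1))) (exp ((- ln (1 - 2 * t) - 2 * t) / 2))"
proof -
  have "integrable M (\<lambda>\<omega>. exp (t * (Z \<omega>)\<^sup>2))"
    and "expectation (\<lambda>\<omega>. exp (t * (Z \<omega>)\<^sup>2)) = 1 / sqrt (1 - 2 * t)"
    using has_bochner_integral_exp_square_std_normal[OF t]
      distributed_integrable[OF Z, of "\<lambda>x. exp (t * x\<^sup>2)"]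
      distributed_integral[OF Z, of "\<lambda>x. exp (t * x\<^sup>2)"]
    by (auto simp: has_bochner_integral_iff)
  then have "has_bochner_integral M (\<lambda>\<omega>. exp (- t) * exp (t * (Z \<omega>)\<^sup>2)) (exp (- t) * (1 / sqrt (1 - 2 * t)))"
    by (intro has_bochner_integral_mult_right) (auto simp: has_bochner_integral_iff)
  moreover have "exp (- t) * exp (t * (Z \<omega>)\<^sup>2) = exp (t * ((Z \<omega>)\<^sup>2 - 1))" for \<omega>
    by (simp add: algebra_simps flip: exp_add)
  moreover have "1 / sqrt (1 - 2 * t) = exp (- ln (1 - 2 * t) / 2)"
    using t by (simp add: exp_minus inverse_eq_divide flip: ln_sqrt)
  then have "exp (- t) * (1 / sqrt (1 - 2 * t)) = exp ((- ln (1 - 2 * t) - 2 * t) / 2)"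
    by (simp add: diff_divide_distrib flip: exp_add)
  ultimately show ?thesis
    by simp
qed

text \<open>
  On the interval \<open>[b, b + 1]\<close> with \<open>b = sqrt a\<close> the density is at least
  \<open>exp (- (b + 1)\<^sup>2 / 2) / sqrt (2 \<pi>)\<close>, and \<open>(b + 1)\<^sup>2 \<le> 2 a + 2\<close>.
\<close>

lemma (in prob_space) std_normal_square_tail_ge:
  assumes Z: "distributed M lborel Z (\<lambda>x. ennreal (std_normal_density x))" and a: "0 \<le> a"
  shows "exp (- 1 - a) / 3 \<le> prob {\<omega> \<in> space M. a \<le> (Z \<omega>)\<^sup>2}"
proof -
  define b where "b = sqrt a"
  have b: "0 \<le> b" "b\<^sup>2 = a"
    using a by (auto simp: b_def)
  have [measurable]: "Z \<in> borel_measurable M"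
    using distributed_measurable[OF Z] by simp
  have "sqrt (2 * pi) \<le> sqrt 9"
    using pi_less_4 by (intro real_sqrt_le_mono) linarith
  then have "sqrt (2 * pi) \<le> 3"
    by simp
  then have "1 / 3 \<le> 1 / sqrt (2 * pi)"
    by (intro divide_left_mono) auto
  have "exp (- 1 - a) / 3 = (\<integral>x. exp (- 1 - a) / 3 * indicator {b..b + 1} x \<partial>lborel)"
    by simp
  also have "\<dots> \<le> (\<integral>x. std_normal_density x * indicator {x. a \<le> x\<^sup>2} x \<partial>lborel)"
  proof (rule integral_mono)
    fix x :: real
    show "exp (- 1 - a) / 3 * indicator {b..b + 1} x
        \<le> std_normal_density x * indicator {x. a \<le> x\<^sup>2} x"
    proof (cases "x \<in> {b..b + 1}")
      case True
      have "0 \<le> (b - 1)\<^sup>2"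
        by simp
      moreover have "(b + 1)\<^sup>2 = 2 * b\<^sup>2 + 2 - (b - 1)\<^sup>2"
        by (simp add: power2_eq_square algebra_simps)
      moreover have "x\<^sup>2 \<le> (b + 1)\<^sup>2"
        using True b(1) by (intro power_mono) simp_all
      moreover have "b\<^sup>2 \<le> x\<^sup>2"
        using True b(1) by (intro power_mono) simp_all
      ultimately have "x\<^sup>2 \<le> 2 * a + 2" "a \<le> x\<^sup>2"
        unfolding b(2) by linarith+
      then have "1 / 3 * exp (- 1 - a) \<le> 1 / sqrt (2 * pi) * exp (- x\<^sup>2 / 2)"
        using \<open>1 / 3 \<le> 1 / sqrt (2 * pi)\<close> by (intro mult_mono) simp_all
      with True \<open>a \<le> x\<^sup>2\<close> show ?thesis
        unfolding std_normal_density_def by simp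
    qed auto
  next
    show "integrable lborel (\<lambda>x. std_normal_density x * indicator {x. a \<le> x\<^sup>2} x)"
      by (intro integrable_real_mult_indicator) auto
  qed auto
  also have "\<dots> = expectation (\<lambda>\<omega>. indicator {x. a \<le> x\<^sup>2} (Z \<omega>))"
    by (rule distributed_integral[OF Z]) auto
  also have "\<dots> = expectation (indicator {\<omega> \<in> space M. a \<le> (Z \<omega>)\<^sup>2})"
    by (rule Bochner_Integration.integral_cong) (auto simp: indicator_def)
  also have "\<dots> = prob {\<omega> \<in> space M. a \<le> (Z \<omega>)\<^sup>2}"
    by simp
  finally show ?thesis .
qed

section \<open>Tails of a centered weighted chi-square variable\<close>

text \<open>
  The index set is arbitrary because the bound for large deviations removes one index and applies
  the lower tail estimate to the remaining sum. Below, \<open>m\<close> stands for a bound on the weights, or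
  for the largest of them where a coordinate attains it.
\<close>

locale weighted_chi_square = prob_space M
  for M :: "'a measure" +
  fixes I :: "'i set" and u :: "'i \<Rightarrow> real" and Z :: "'i \<Rightarrow> 'a \<Rightarrow> real"
  assumes finite_I: "finite I"
    and u_nonneg: "i \<in> I \<Longrightarrow> 0 \<le> u i"
    and indep_Z: "indep_vars (\<lambda>_. borel) Z I"
    and std_normal_Z: "i \<in> I \<Longrightarrow> distributed M lborel (Z i) (\<lambda>x. ennreal (std_normal_density x))"
begin

definition X :: "'a \<Rightarrow> real" where
  "X \<omega> = (\<Sum>i\<in>I. u i * ((Z i \<omega>)\<^sup>2 - 1))"

definition V :: real where
  "V = (\<Sum>i\<in>I. (u i)\<^sup>2)"

lemma measurable_Z [measurable (raw)]: "i \<in> I \<Longrightarrow> Z i \<in> borel_measurable M"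
  using distributed_measurable[OF std_normal_Z, of i] by simp

lemma measurable_X [measurable]: "X \<in> borel_measurable M"
  unfolding X_def[abs_def] by measurable

lemma V_nonneg: "0 \<le> V"
  unfolding V_def by (simp add: sum_nonneg)

lemma mgf_X:
  assumes "\<And>i. i \<in> I \<Longrightarrow> 2 * (t * u i) < 1"
  shows "integrable M (\<lambda>\<omega>. exp (t * X \<omega>))"
    and "expectation (\<lambda>\<omega>. exp (t * X \<omega>))
      = exp (\<Sum>i\<in>I. (- ln (1 - 2 * (t * u i)) - 2 * (t * u i)) / 2)"
proof -
  have prod: "exp (t * X \<omega>) = (\<Prod>i\<in>I. exp (t * u i * ((Z i \<omega>)\<^sup>2 - 1)))" for \<omega>
    by (simp add: X_def sum_distrib_left exp_sum finite_I mult.assoc)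
  have factor: "has_bochner_integral M (\<lambda>\<omega>. exp (t * u i * ((Z i \<omega>)\<^sup>2 - 1)))
      (exp ((- ln (1 - 2 * (t * u i)) - 2 * (t * u i)) / 2))" if "i \<in> I" for i
    using mgf_centered_std_normal_square[OF std_normal_Z[OF that], of "t * u i"] assms[OF that]
    by simp
  have indep: "indep_vars (\<lambda>_. borel) (\<lambda>i \<omega>. exp (t * u i * ((Z i \<omega>)\<^sup>2 - 1))) I"
    by (rule indep_vars_compose2[OF indep_Z]) measurable
  have int: "integrable M (\<lambda>\<omega>. exp (t * u i * ((Z i \<omega>)\<^sup>2 - 1)))" if "i \<in> I" for i
    using factor[OF that] by (simp add: has_bochner_integral_iff)
  show "integrable M (\<lambda>\<omega>. exp (t * X \<omega>))"
    unfolding prod by (rule indep_vars_integrable[OF finite_I indep int])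
  have "expectation (\<lambda>\<omega>. exp (t * X \<omega>)) = (\<Prod>i\<in>I. exp ((- ln (1 - 2 * (t * u i)) - 2 * (t * u i)) / 2))"
    unfolding prod
    by (subst indep_vars_lebesgue_integral[OF finite_I indep int])
       (use factor in \<open>auto simp: has_bochner_integral_iff intro!: prod.cong\<close>)
  then show "expectation (\<lambda>\<omega>. exp (t * X \<omega>))
      = exp (\<Sum>i\<in>I. (- ln (1 - 2 * (t * u i)) - 2 * (t * u i)) / 2)"
    by (simp only: exp_sum[OF finite_I])
qed

lemma t_square_V: "t\<^sup>2 * V = (\<Sum>i\<in>I. (t * u i)\<^sup>2)"
  by (simp add: V_def sum_distrib_left power_mult_distrib)

text \<open>
  With \<open>s = 2 t u\<^sub>i\<close>, each summand of the exponent in \<open>mgf_X\<close> is half of \<open>- ln (1 - s) - s\<close>, and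
  \<open>s\<^sup>2 = 4 t\<^sup>2 u\<^sub>i\<^sup>2\<close>. Summing a bound that is quadratic in \<open>s\<close> gives a multiple of \<open>t\<^sup>2 V\<close>; the next
  two lemmas do the same with the other quadratic bounds.
\<close>

lemma mgf_X_le:
  assumes "\<And>i. i \<in> I \<Longrightarrow> t * u i \<le> 1 / 4"
  shows "integrable M (\<lambda>\<omega>. exp (t * X \<omega>))"
    and "expectation (\<lambda>\<omega>. exp (t * X \<omega>)) \<le> exp (2 * (t\<^sup>2 * V))"
proof -
  have less: "2 * (t * u i) < 1" if "i \<in> I" for i
    using assms[OF that] by simp
  show "integrable M (\<lambda>\<omega>. exp (t * X \<omega>))"
    by (rule mgf_X(1)[OF less])
  have mgf: "expectation (\<lambda>\<omega>. exp (t * X \<omega>))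
      = exp (\<Sum>i\<in>I. (- ln (1 - 2 * (t * u i)) - 2 * (t * u i)) / 2)"
    by (rule mgf_X(2)[OF less])
  have "(- ln (1 - 2 * (t * u i)) - 2 * (t * u i)) / 2 \<le> 2 * (t * u i)\<^sup>2" if "i \<in> I" for i
    using minus_ln_one_minus_le[of "2 * (t * u i)"] assms[OF that]
    unfolding power_mult_distrib[of 2] by simp
  then show "expectation (\<lambda>\<omega>. exp (t * X \<omega>)) \<le> exp (2 * (t\<^sup>2 * V))"
    unfolding mgf exp_le_cancel_iff t_square_V sum_distrib_left by (rule sum_mono)
qed

lemma mgf_X_nonpos_le:
  assumes "t \<le> 0"
  shows "integrable M (\<lambda>\<omega>. exp (t * X \<omega>))"
    and "expectation (\<lambda>\<omega>. exp (t * X \<omega>)) \<le> exp (t\<^sup>2 * V)"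
proof -
  have nonpos: "t * u i \<le> 0" if "i \<in> I" for i
    using assms u_nonneg[OF that] by (simp add: mult_nonpos_nonneg)
  have less: "2 * (t * u i) < 1" if "i \<in> I" for i
    using nonpos[OF that] by simp
  show "integrable M (\<lambda>\<omega>. exp (t * X \<omega>))"
    by (rule mgf_X(1)[OF less])
  have mgf: "expectation (\<lambda>\<omega>. exp (t * X \<omega>))
      = exp (\<Sum>i\<in>I. (- ln (1 - 2 * (t * u i)) - 2 * (t * u i)) / 2)"
    by (rule mgf_X(2)[OF less])
  have "(- ln (1 - 2 * (t * u i)) - 2 * (t * u i)) / 2 \<le> (t * u i)\<^sup>2" if "i \<in> I" for i
    using minus_ln_one_minus_le_half[of "2 * (t * u i)"] nonpos[OF that]
    unfolding power_mult_distrib[of 2] by simp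
  then show "expectation (\<lambda>\<omega>. exp (t * X \<omega>)) \<le> exp (t\<^sup>2 * V)"
    unfolding mgf exp_le_cancel_iff t_square_V by (rule sum_mono)
qed

lemma mgf_X_ge:
  assumes "\<And>i. i \<in> I \<Longrightarrow> \<bar>t * u i\<bar> \<le> 1 / 4"
  shows "exp (t\<^sup>2 * V / 2) \<le> expectation (\<lambda>\<omega>. exp (t * X \<omega>))"
proof -
  have range: "- 1 \<le> 2 * (t * u i)" "2 * (t * u i) < 1" if "i \<in> I" for i
    using assms[OF that] by linarith+
  have mgf: "expectation (\<lambda>\<omega>. exp (t * X \<omega>))
      = exp (\<Sum>i\<in>I. (- ln (1 - 2 * (t * u i)) - 2 * (t * u i)) / 2)"
    by (rule mgf_X(2)[OF range(2)])
  have "(t * u i)\<^sup>2 / 2 \<le> (- ln (1 - 2 * (t * u i)) - 2 * (t * u i)) / 2" if "i \<in> I" for i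
    using minus_ln_one_minus_ge[OF range[OF that]] unfolding power_mult_distrib[of 2] by simp
  then show ?thesis
    unfolding mgf exp_le_cancel_iff t_square_V sum_divide_distrib by (rule sum_mono)
qed

lemma upper_tail_le:
  assumes "0 \<le> t" "\<And>i. i \<in> I \<Longrightarrow> t * u i \<le> 1 / 4"
  shows "prob {\<omega> \<in> space M. x \<le> X \<omega>} \<le> exp (- (t * x) + 2 * (t\<^sup>2 * V))"
proof -
  have "prob {\<omega> \<in> space M. x \<le> X \<omega>} \<le> prob {\<omega> \<in> space M. t * x \<le> t * X \<omega>}"
    using assms(1) by (intro finite_measure_mono subsetI CollectI conjI mult_left_mono) auto
  also have "\<dots> \<le> exp (- (t * x)) * expectation (\<lambda>\<omega>. exp (t * X \<omega>))"
    by (rule Chernoff[OF mgf_X_le(1)[OF assms(2)]])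
  also have "\<dots> \<le> exp (- (t * x)) * exp (2 * (t\<^sup>2 * V))"
    by (intro mult_left_mono mgf_X_le(2)[OF assms(2)]) simp_all
  finally show ?thesis
    unfolding exp_add .
qed

text \<open>
  Negative \<open>t\<close> meet no pole of the generating function, so the optimal choice \<open>t = - x / (2 v)\<close> is
  admissible for all \<open>x\<close>. The slack \<open>V \<le> v\<close> allows \<open>V = 0\<close>, which occurs when the removal of an
  index leaves no positive weight.
\<close>

lemma lower_tail_le:
  assumes "0 \<le> x" "V \<le> v" "0 < v"
  shows "prob {\<omega> \<in> space M. X \<omega> \<le> - x} \<le> exp (- (x\<^sup>2) / (4 * v))"
proof -
  define t where "t = - (x / (2 * v))"
  have t: "t \<le> 0"
    using assms by (simp add: t_def)
  have "prob {\<omega> \<in> space M. X \<omega> \<le> - x} \<le> prob {\<omega> \<in> space M. t * (- x) \<le> t * X \<omega>}"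
    using t by (intro finite_measure_mono subsetI CollectI conjI mult_left_mono_neg) auto
  also have "\<dots> \<le> exp (- (t * (- x))) * expectation (\<lambda>\<omega>. exp (t * X \<omega>))"
    by (rule Chernoff[OF mgf_X_nonpos_le(1)[OF t]])
  also have "\<dots> \<le> exp (- (t * (- x))) * exp (t\<^sup>2 * V)"
    by (rule mult_left_mono[OF mgf_X_nonpos_le(2)[OF t]]) simp
  also have "\<dots> \<le> exp (- (t * (- x))) * exp (t\<^sup>2 * v)"
    using assms(2) by (simp add: mult_left_mono)
  also have "\<dots> = exp (t * x + t\<^sup>2 * v)"
    by (simp add: exp_add)
  also have "t * x + t\<^sup>2 * v = - (x\<^sup>2) / (4 * v)"
    using assms(3) by (simp add: t_def power2_eq_square field_simps)
  finally show ?thesis .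
qed

text \<open>
  This is the Paley--Zygmund inequality for \<open>exp (t X)\<close>, with both signs of \<open>t\<close> treated at once. With
  \<open>q = t\<^sup>2 V\<close>, the mean is at least \<open>exp (q / 2)\<close> and the second moment at most \<open>exp (8 q)\<close>. The
  threshold \<open>\<theta> = exp (- q / 4)\<close> depends on \<open>q\<close>, unlike a constant one, so that \<open>\<theta>\<close> times the mean
  is at least \<open>1\<close> even when \<open>q\<close> is small. This makes it possible to use \<open>t\<close> of order \<open>1 / sqrt V\<close>,
  which is admissible for all weights because \<open>m \<le> sqrt V\<close>.
\<close>

lemma two_sided_tail_ge:
  assumes "\<And>i. i \<in> I \<Longrightarrow> \<bar>t * u i\<bar> \<le> 1 / 8"
  shows "(1 - exp (- (t\<^sup>2 * V / 4)))\<^sup>2 * exp (- 7 * (t\<^sup>2 * V))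
    \<le> prob {\<omega> \<in> space M. t\<^sup>2 * V / 4 \<le> t * X \<omega>}"
proof -
  define q where "q = t\<^sup>2 * V"
  have q: "0 \<le> q"
    using V_nonneg by (simp add: q_def)
  have small: "t * u i \<le> 1 / 4" "\<bar>t * u i\<bar> \<le> 1 / 4" "2 * t * u i \<le> 1 / 4" if "i \<in> I" for i
    using assms[OF that] by linarith+
  have sq: "(exp (t * X \<omega>))\<^sup>2 = exp (2 * t * X \<omega>)" for \<omega>
    by (simp add: power2_eq_square flip: exp_add)
  have "(1 - exp (- (q / 4)))\<^sup>2 * (exp (q / 2))\<^sup>2 / exp (8 * q)
      \<le> prob {\<omega> \<in> space M. exp (- (q / 4)) * exp (q / 2) \<le> exp (t * X \<omega>)}"
  proof (rule Paley_Zygmund)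
    show "integrable M (\<lambda>\<omega>. exp (t * X \<omega>))"
      by (rule mgf_X_le(1)[OF small(1)])
    show "integrable M (\<lambda>\<omega>. (exp (t * X \<omega>))\<^sup>2)"
      unfolding sq by (rule mgf_X_le(1)[OF small(3)])
    show "exp (q / 2) \<le> expectation (\<lambda>\<omega>. exp (t * X \<omega>))"
      unfolding q_def by (rule mgf_X_ge[OF small(2)])
    show "expectation (\<lambda>\<omega>. (exp (t * X \<omega>))\<^sup>2) \<le> exp (8 * q)"
      using mgf_X_le(2)[of "2 * t", OF small(3)] unfolding sq q_def power_mult_distrib[of 2] by simp
  qed (use q in auto)
  moreover have "(exp (q / 2))\<^sup>2 / exp (8 * q) = exp (- 7 * q)"
    by (simp add: power2_eq_square flip: exp_add exp_diff)
  moreover have "exp (- (q / 4)) * exp (q / 2) = exp (q / 4)"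
    by (simp flip: exp_add)
  ultimately show ?thesis
    unfolding q_def[symmetric] by (simp only: times_divide_eq_right[symmetric] exp_le_cancel_iff)
qed

text \<open>
  Take \<open>t = 4 x / V + 1 / (16 sqrt V)\<close> and its negative in \<open>two_sided_tail_ge\<close>. The first summand makes
  \<open>t V / 4\<close> at least \<open>x\<close>. The second keeps \<open>t\<^sup>2 V \<ge> 1 / 256\<close>, so that the factor
  \<open>1 - exp (- t\<^sup>2 V / 4)\<close> stays away from \<open>0\<close> when \<open>x\<close> is small. Each summand contributes at most
  \<open>1 / (16 m)\<close> to \<open>t\<close>, the first one exactly because \<open>x \<le> V / (64 m)\<close>.
\<close>

lemma tails_ge_gaussian:
  assumes "\<And>i. i \<in> I \<Longrightarrow> u i \<le> m" "0 < m" "m\<^sup>2 \<le> V"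
    and x: "0 \<le> x" "x \<le> V / (64 * m)"
  defines "\<kappa> \<equiv> (1 - exp (- 1 / 1024))\<^sup>2 * exp (- 7 / 128)"
  shows "\<kappa> * exp (- 224 * x\<^sup>2 / V) \<le> prob {\<omega> \<in> space M. x \<le> X \<omega>}"
    and "\<kappa> * exp (- 224 * x\<^sup>2 / V) \<le> prob {\<omega> \<in> space M. X \<omega> \<le> - x}"
proof -
  define r where "r = sqrt V"
  have "0 < m\<^sup>2"
    using \<open>0 < m\<close> by simp
  with \<open>m\<^sup>2 \<le> V\<close> have V: "0 < V"
    by linarith
  have r: "0 < r" "r\<^sup>2 = V" "m \<le> r"
    using V \<open>m\<^sup>2 \<le> V\<close> \<open>0 < m\<close> by (auto simp: r_def intro: real_le_rsqrt)
  define t where "t = 4 * x / V + 1 / (16 * r)"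
  define q where "q = t\<^sup>2 * V"
  have t: "0 < t"
    using V x r by (simp add: t_def add_nonneg_pos)
  have "x / V \<le> 1 / (64 * m)"
    using x(2) V \<open>0 < m\<close> by (simp add: field_simps)
  moreover have "1 / r \<le> 1 / m"
    using r \<open>0 < m\<close> by (simp add: field_simps)
  moreover have "t * m = (4 * (x / V) + 1 / 16 * (1 / r)) * m"
    by (simp add: t_def)
  ultimately have "t * m \<le> (4 * (1 / (64 * m)) + 1 / 16 * (1 / m)) * m"
    using \<open>0 < m\<close> by (simp only:) (intro mult_right_mono add_mono mult_left_mono; simp)
  also have "\<dots> = 1 / 8"
    using \<open>0 < m\<close> by (simp add: field_simps)
  finally have tm: "t * m \<le> 1 / 8" .
  have tu: "\<bar>t * u i\<bar> \<le> 1 / 8" if "i \<in> I" for i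
  proof -
    have "t * u i \<le> t * m"
      using t assms(1)[OF that] by (intro mult_left_mono) simp_all
    moreover have "0 \<le> t * u i"
      using t u_nonneg[OF that] by simp
    ultimately show ?thesis
      using tm by linarith
  qed
  have tr: "t * r = 4 * (x / r) + 1 / 16"
    using r(1) unfolding t_def r(2)[symmetric] by (simp add: field_simps power2_eq_square)
  have q_r: "q = (t * r)\<^sup>2"
    by (simp add: q_def r(2)[symmetric] power_mult_distrib)
  have "(1 / 16)\<^sup>2 \<le> (t * r)\<^sup>2"
    using x r unfolding tr by (intro power_mono) auto
  then have q_ge: "1 / 256 \<le> q"
    by (simp add: q_r power2_eq_square)
  have "q \<le> 2 * (4 * (x / r))\<^sup>2 + 2 * (1 / 16)\<^sup>2"
    using zero_le_power2[of "4 * (x / r) - 1 / 16"] unfolding q_r tr power2_diff power2_sum by linarith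
  also have "\<dots> = 32 * (x\<^sup>2 / V) + 1 / 128"
    by (simp add: power_mult_distrib power_divide r(2))
  finally have q_le: "q \<le> 32 * (x\<^sup>2 / V) + 1 / 128" .
  have x_le: "x \<le> t * V / 4"
    using V r(1) by (simp add: t_def distrib_right)
  have "\<kappa> * exp (- 224 * x\<^sup>2 / V) = (1 - exp (- 1 / 1024))\<^sup>2 * exp (- 7 * (32 * (x\<^sup>2 / V) + 1 / 128))"
    by (simp add: \<kappa>_def mult.assoc flip: exp_add)
  also have "\<dots> \<le> (1 - exp (- (q / 4)))\<^sup>2 * exp (- 7 * q)"
    using q_ge q_le by (intro mult_mono power_mono) simp_all
  finally have main: "\<kappa> * exp (- 224 * x\<^sup>2 / V) \<le> (1 - exp (- (q / 4)))\<^sup>2 * exp (- 7 * q)" .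

  have "(1 - exp (- (q / 4)))\<^sup>2 * exp (- 7 * q) \<le> prob {\<omega> \<in> space M. q / 4 \<le> t * X \<omega>}"
    using two_sided_tail_ge[of t, OF tu] unfolding q_def .
  also have "\<dots> \<le> prob {\<omega> \<in> space M. x \<le> X \<omega>}"
  proof (rule finite_measure_mono)
    show "{\<omega> \<in> space M. q / 4 \<le> t * X \<omega>} \<subseteq> {\<omega> \<in> space M. x \<le> X \<omega>}"
    proof safe
      fix \<omega> assume "q / 4 \<le> t * X \<omega>"
      then have "t * (t * V / 4) \<le> t * X \<omega>"
        by (simp add: q_def power2_eq_square mult.assoc)
      then have "t * V / 4 \<le> X \<omega>"
        using t by (rule mult_left_le_imp_le)
      with x_le show "x \<le> X \<omega>"
        by simp
    qed
  qed simp
  finally show "\<kappa> * exp (- 224 * x\<^sup>2 / V) \<le> prob {\<omega> \<in> space M. x \<le> X \<omega>}"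
    using main by simp

  have tu': "\<bar>- t * u i\<bar> \<le> 1 / 8" if "i \<in> I" for i
    using tu[OF that] by simp
  have "(1 - exp (- (q / 4)))\<^sup>2 * exp (- 7 * q) \<le> prob {\<omega> \<in> space M. q / 4 \<le> - t * X \<omega>}"
    using two_sided_tail_ge[of "- t", OF tu'] unfolding q_def power2_minus .
  also have "\<dots> \<le> prob {\<omega> \<in> space M. X \<omega> \<le> - x}"
  proof (rule finite_measure_mono)
    show "{\<omega> \<in> space M. q / 4 \<le> - t * X \<omega>} \<subseteq> {\<omega> \<in> space M. X \<omega> \<le> - x}"
    proof safe
      fix \<omega> assume "q / 4 \<le> - t * X \<omega>"
      then have "t * (t * V / 4) \<le> t * - X \<omega>"
        by (simp add: q_def power2_eq_square mult.assoc)
      then have "t * V / 4 \<le> - X \<omega>"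
        using t by (rule mult_left_le_imp_le)
      with x_le show "X \<omega> \<le> - x"
        by simp
    qed
  qed simp
  finally show "\<kappa> * exp (- 224 * x\<^sup>2 / V) \<le> prob {\<omega> \<in> space M. X \<omega> \<le> - x}"
    using main by simp
qed

text \<open>
  Large deviations are produced by the coordinate of largest weight alone: let it overshoot
  \<open>x + 2 sqrt V\<close>, while the independent remaining sum stays above \<open>- 2 sqrt V\<close>, which by
  \<open>R.lower_tail_le\<close> it does with probability at least \<open>1 - exp (- 1) \<ge> 1 / 2\<close>. The overshoot is
  affordable because \<open>2 sqrt V / m \<le> 1 + V / m\<^sup>2\<close>, and \<open>V / m\<^sup>2 \<le> 64 x / m\<close> in the given range.
\<close>

lemma upper_tail_ge_exponential:
  assumes j: "j \<in> I" and m: "u j = m" "0 < m" and x: "V / (64 * m) \<le> x"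
  shows "exp (- 3) / 6 * exp (- 65 * x / m) \<le> prob {\<omega> \<in> space M. x \<le> X \<omega>}"
proof -
  interpret R: weighted_chi_square M "I - {j}" u Z
    by unfold_locales (use finite_I u_nonneg indep_vars_subset[OF indep_Z] std_normal_Z in auto)
  define Y where "Y i \<omega> = u i * ((Z i \<omega>)\<^sup>2 - 1)" for i \<omega>
  have X_eq: "X \<omega> = Y j \<omega> + R.X \<omega>" for \<omega>
    unfolding X_def R.X_def Y_def by (rule sum.remove[OF finite_I j])
  have V_eq: "V = m\<^sup>2 + R.V"
    unfolding V_def R.V_def m(1)[symmetric] by (rule sum.remove[OF finite_I j])
  have V: "0 < V" "R.V \<le> V"
    using V_eq R.V_nonneg m(2) by (auto intro: add_pos_nonneg)
  define s where "s = 2 * sqrt V"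
  have s: "0 \<le> s" "s\<^sup>2 = 4 * V"
    using V by (auto simp: s_def power_mult_distrib)
  define a where "a = 1 + (x + s) / m"
  have "0 \<le> V / (64 * m)"
    using V m by simp
  with x have "0 \<le> x"
    by linarith
  then have a: "0 \<le> a"
    using s m by (simp add: a_def)

  have "V / m\<^sup>2 \<le> 64 * x / m"
    using x m by (simp add: field_simps power2_eq_square)
  moreover have "(s / (2 * m))\<^sup>2 = V / m\<^sup>2"
    by (simp add: power_divide power_mult_distrib s)
  moreover have "s / m \<le> 1 + (s / (2 * m))\<^sup>2"
    using zero_le_power2[of "s / (2 * m) - 1"] unfolding power2_diff by simp
  ultimately have a_le: "a \<le> 2 + 65 * x / m"
    by (simp add: a_def add_divide_distrib)

  have indep: "indep_var borel (Y j) borel R.X"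
  proof -
    have "indep_vars (\<lambda>_. borel) Y (insert j (I - {j}))"
      unfolding insert_Diff[OF j] Y_def[abs_def] by (rule indep_vars_compose2[OF indep_Z]) measurable
    from indep_vars_sum[OF _ _ this] show ?thesis
      using finite_I by (simp add: R.X_def[abs_def] Y_def)
  qed
  have [measurable]: "Y j \<in> borel_measurable M"
    using j unfolding Y_def[abs_def] by measurable

  have coordinate: "exp (- 3 - 65 * x / m) / 3 \<le> prob (Y j -` {x + s..} \<inter> space M)"
  proof -
    have "exp (- 3 - 65 * x / m) / 3 \<le> exp (- 1 - a) / 3"
      using a_le by simp
    also have "\<dots> \<le> prob {\<omega> \<in> space M. a \<le> (Z j \<omega>)\<^sup>2}"
      by (rule std_normal_square_tail_ge[OF std_normal_Z[OF j] a])
    also have "{\<omega> \<in> space M. a \<le> (Z j \<omega>)\<^sup>2} = Y j -` {x + s..} \<inter> space M"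
      using m by (auto simp: Y_def a_def field_simps)
    finally show ?thesis .
  qed
  have rest: "1 / 2 \<le> prob (R.X -` {- s<..} \<inter> space M)"
  proof -
    have "prob {\<omega> \<in> space M. R.X \<omega> \<le> - s} \<le> exp (- (s\<^sup>2) / (4 * V))"
      by (rule R.lower_tail_le[OF s(1) V(2) V(1)])
    also have "\<dots> = exp (- 1)"
      using V by (simp add: s(2))
    also have "\<dots> \<le> 1 / 2"
      using exp_ge_add_one_self[of 1] by (simp add: exp_minus field_simps)
    finally have "prob {\<omega> \<in> space M. R.X \<omega> \<le> - s} \<le> 1 / 2" .
    moreover have "R.X -` {- s<..} \<inter> space M = space M - {\<omega> \<in> space M. R.X \<omega> \<le> - s}"
      by auto
    ultimately show ?thesis
      by (simp add: prob_compl)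
  qed
  have "exp (- 3) / 6 * exp (- 65 * x / m) = exp (- 3 - 65 * x / m) / 3 * (1 / 2)"
    by (simp add: exp_diff exp_minus field_simps)
  also have "\<dots> \<le> prob (Y j -` {x + s..} \<inter> space M) * prob (R.X -` {- s<..} \<inter> space M)"
    using coordinate rest by (intro mult_mono) auto
  also have "\<dots> = prob ((\<lambda>\<omega>. (Y j \<omega>, R.X \<omega>)) -` ({x + s..} \<times> {- s<..}) \<inter> space M)"
    by (rule indep_varD[OF indep, symmetric]) auto
  also have "\<dots> \<le> prob {\<omega> \<in> space M. x \<le> X \<omega>}"
    by (rule finite_measure_mono) (auto simp: X_eq)
  finally show ?thesis .
qed

text \<open>
  The parameter \<open>t = x / (4 V)\<close> that is optimal for \<open>- t x + 2 t\<^sup>2 V\<close> satisfies \<open>t m \<le> 1 / 4\<close> exactly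
  when \<open>x \<le> V / m\<close>. Beyond this point the largest admissible value \<open>1 / (4 m)\<close> replaces it, which
  gives the exponential bound that follows.
\<close>

lemma upper_tail_le_gaussian:
  assumes "\<And>i. i \<in> I \<Longrightarrow> u i \<le> m" "0 < m" "0 < V" "0 \<le> x" "x \<le> V / m"
  shows "prob {\<omega> \<in> space M. x \<le> X \<omega>} \<le> exp (- (1 / 8) * x\<^sup>2 / V)"
proof -
  define t where "t = x / (4 * V)"
  have "t * u i \<le> 1 / 4" if "i \<in> I" for i
  proof -
    have "t * u i \<le> t * m"
      using assms that by (intro mult_left_mono) (simp_all add: t_def)
    also have "\<dots> \<le> 1 / 4"
      using assms by (simp add: t_def field_simps)
    finally show ?thesis .
  qed
  then have "prob {\<omega> \<in> space M. x \<le> X \<omega>} \<le> exp (- (t * x) + 2 * (t\<^sup>2 * V))"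
    using assms by (intro upper_tail_le) (simp_all add: t_def)
  also have "- (t * x) + 2 * (t\<^sup>2 * V) = - (1 / 8) * x\<^sup>2 / V"
    using assms(3) by (simp add: t_def field_simps power2_eq_square)
  finally show ?thesis .
qed

lemma upper_tail_le_exponential:
  assumes "\<And>i. i \<in> I \<Longrightarrow> u i \<le> m" "0 < m" "V / m \<le> x"
  shows "prob {\<omega> \<in> space M. x \<le> X \<omega>} \<le> exp (- (1 / 8) * x / m)"
proof -
  define t where "t = 1 / (4 * m)"
  have "t * u i \<le> 1 / 4" if "i \<in> I" for i
    using assms(1)[OF that] assms(2) by (simp add: t_def field_simps)
  then have "prob {\<omega> \<in> space M. x \<le> X \<omega>} \<le> exp (- (t * x) + 2 * (t\<^sup>2 * V))"
    using assms by (intro upper_tail_le) (simp_all add: t_def)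
  also have "- (t * x) + 2 * (t\<^sup>2 * V) \<le> - (1 / 8) * x / m"
    using assms by (simp add: t_def field_simps power2_eq_square)
  finally show ?thesis
    by simp
qed

end

section \<open>Universal constants\<close>

lemma norm_inf_properties:
  assumes nonneg: "\<forall>i\<in>{1..k}. 0 \<le> u i" and nonzero: "\<exists>i\<in>{1..k}. u i \<noteq> 0"
  shows "\<And>i. i \<in> {1..k} \<Longrightarrow> u i \<le> norm_inf k u"
    and "\<exists>j\<in>{1..k}. u j = norm_inf k u"
    and "0 < norm_inf k u"
    and "(norm_inf k u)\<^sup>2 \<le> (\<Sum>i=1..k. (u i)\<^sup>2)"
proof -
  have abs_le: "\<bar>u i\<bar> \<le> norm_inf k u" if "i \<in> {1..k}" for i
    unfolding norm_inf_def using that by (intro Max_ge) auto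
  show "u i \<le> norm_inf k u" if "i \<in> {1..k}" for i
    using abs_le[OF that] by simp
  show attained: "\<exists>j\<in>{1..k}. u j = norm_inf k u"
  proof -
    have "norm_inf k u \<in> (\<lambda>i. \<bar>u i\<bar>) ` {1..k}"
      unfolding norm_inf_def using nonzero by (intro Max_in) auto
    with nonneg show ?thesis
      by auto
  qed
  show "0 < norm_inf k u"
  proof -
    obtain i where "i \<in> {1..k}" "u i \<noteq> 0"
      using nonzero by blast
    with abs_le[of i] show ?thesis
      by linarith
  qed
  show "(norm_inf k u)\<^sup>2 \<le> (\<Sum>i=1..k. (u i)\<^sup>2)"
  proof -
    obtain j where "j \<in> {1..k}" "u j = norm_inf k u"
      using attained by blast
    with member_le_sum[of j "{1..k}" "\<lambda>i. (u i)\<^sup>2"] show ?thesis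
      by simp
  qed
qed

text \<open>
  The Gaussian and the exponential lower bound for the upper tail meet at \<open>x = V / (64 m)\<close>, whereas
  the regimes of the claim meet at \<open>x = V / m\<close>. In between, \<open>x / m \<le> 64 x\<^sup>2 / V\<close>, so the exponential
  bound is also a Gaussian one, with rate \<open>64 * 65 = 4160\<close>.
\<close>

lemma chi_square_tail_bounds_explicit:
  defines "\<kappa> \<equiv> (1 - exp (- 1 / 1024))\<^sup>2 * exp (- 7 / 128)"
  shows "chi_square_tail_bounds TYPE('a)
    (min \<kappa> (exp (- 3) / 6)) 4160 (1 / 8) (exp (- 3) / 6) 65 \<kappa> 224 (1 / 64)"
  unfolding chi_square_tail_bounds_def Let_def
proof (intro allI impI, goal_cases)
  case (1 k u M Z)
  note u = 1(1,2) and iid = 1(3)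
  interpret prob_space M
    using iid by (simp add: iid_std_normal_def)
  interpret weighted_chi_square M "{1..k}" u Z
    by unfold_locales (use iid u in \<open>auto simp: iid_std_normal_def\<close>)
  have X_eq: "centered_weighted_chi_square k u Z = X"
    unfolding fun_eq_iff centered_weighted_chi_square_def X_def right_diff_distrib sum_subtractf
      mult_1_right by simp
  have V_eq: "(L2_set u {1..k})\<^sup>2 = V"
    unfolding L2_set_def V_def by (intro real_sqrt_pow2 sum_nonneg) simp
  define m where "m = norm_inf k u"
  note max = norm_inf_properties[OF u, folded m_def]
  have V: "0 < V" "m\<^sup>2 \<le> V"
    using max(3,4) zero_less_power[OF max(3), of 2] unfolding V_def by linarith+
  obtain j where j: "j \<in> {1..k}" "u j = m"
    using max(2) by blast

  have small: "(min \<kappa> (exp (- 3) / 6)) * exp (- 4160 * x\<^sup>2 / V) \<le> prob {\<omega> \<in> space M. x \<le> X \<omega>}"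
    if x: "0 \<le> x" "x \<le> V / m" for x
  proof (cases "x \<le> V / (64 * m)")
    case True
    have "- 4160 * x\<^sup>2 / V \<le> - 224 * x\<^sup>2 / V"
      using V by (simp add: divide_right_mono)
    then have "(min \<kappa> (exp (- 3) / 6)) * exp (- 4160 * x\<^sup>2 / V) \<le> \<kappa> * exp (- 224 * x\<^sup>2 / V)"
      by (intro mult_mono) (simp_all add: \<kappa>_def)
    also have "\<dots> \<le> prob {\<omega> \<in> space M. x \<le> X \<omega>}"
      unfolding \<kappa>_def by (rule tails_ge_gaussian(1)[OF max(1) max(3) V(2) x(1) True])
    finally show ?thesis .
  next
    case False
    then have "V / (64 * m) < x"
      by simp
    then have "V \<le> x * (64 * m)"
      using max(3) by (simp add: pos_divide_less_eq)
    then have "x * V \<le> x * (x * (64 * m))"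
      using x(1) by (rule mult_left_mono)
    then have "x / m \<le> 64 * (x\<^sup>2 / V)"
      using max(3) V(1) by (simp add: field_simps power2_eq_square)
    then have "- 4160 * x\<^sup>2 / V \<le> - 65 * x / m"
      by simp
    then have "(min \<kappa> (exp (- 3) / 6)) * exp (- 4160 * x\<^sup>2 / V) \<le> exp (- 3) / 6 * exp (- 65 * x / m)"
      by (intro mult_mono) simp_all
    also have "\<dots> \<le> prob {\<omega> \<in> space M. x \<le> X \<omega>}"
      using False by (intro upper_tail_ge_exponential[OF j max(3)]) simp
    finally show ?thesis .
  qed
  have large: "exp (- 3) / 6 * exp (- 65 * x / m) \<le> prob {\<omega> \<in> space M. x \<le> X \<omega>}" if x: "V / m < x" for x
  proof (rule upper_tail_ge_exponential[OF j max(3)])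
    have "V / (64 * m) \<le> V / m"
      using V(1) max(3) by (intro divide_left_mono) simp_all
    with x show "V / (64 * m) \<le> x"
      by simp
  qed
  have lower: "\<kappa> * exp (- 224 * x\<^sup>2 / V) \<le> prob {\<omega> \<in> space M. X \<omega> \<le> - x}"
    "prob {\<omega> \<in> space M. X \<omega> \<le> - x} \<le> exp (- (1 / 4) * x\<^sup>2 / V)"
    if x: "0 \<le> x" "x \<le> 1 / 64 * (V / m)" for x
  proof -
    have "x \<le> V / (64 * m)"
      using x(2) by simp
    then show "\<kappa> * exp (- 224 * x\<^sup>2 / V) \<le> prob {\<omega> \<in> space M. X \<omega> \<le> - x}"
      unfolding \<kappa>_def by (intro tails_ge_gaussian(2)[OF max(1) max(3) V(2) x(1)])
    show "prob {\<omega> \<in> space M. X \<omega> \<le> - x} \<le> exp (- (1 / 4) * x\<^sup>2 / V)"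
      using lower_tail_le[OF x(1) order_refl V(1)] by simp
  qed
  have upper_small: "prob {\<omega> \<in> space M. x \<le> X \<omega>} \<le> exp (- (1 / 8) * x\<^sup>2 / V)"
    if "0 \<le> x" "x \<le> V / m" for x
    using upper_tail_le_gaussian[OF max(1) max(3) V(1) that] by blast
  have upper_large: "prob {\<omega> \<in> space M. x \<le> X \<omega>} \<le> exp (- (1 / 8) * x / m)" if "V / m < x" for x
    using upper_tail_le_exponential[OF max(1) max(3) less_imp_le[OF that]] by blast
  show ?case
    unfolding X_eq V_eq m_def[symmetric] using small large lower upper_small upper_large by blast
qed

section \<open>Independence of the sample space\<close>

text \<open>
  Independence of a finite family and its marginal laws are properties of its joint law, so the
  coordinates under the joint law of \<open>Z\<close> are again an i.i.d. standard normal family. Their sample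
  space consists of real functions of natural numbers, whatever the original one was.
\<close>

lemma iid_std_normal_pushforward:
  assumes "iid_std_normal M k Z" "k \<noteq> 0"
  defines "F \<equiv> (\<lambda>\<omega>. \<lambda>i\<in>{1..k}. Z i \<omega>)"
  defines "N \<equiv> distr M (\<Pi>\<^sub>M i\<in>{1..k}. borel) F"
  shows "F \<in> measurable M (\<Pi>\<^sub>M i\<in>{1..k}. borel)"
    and "iid_std_normal N k (\<lambda>i f. f i)"
proof -
  interpret prob_space M
    using assms by (simp add: iid_std_normal_def)
  have indep: "indep_vars (\<lambda>_. borel) Z {1..k}"
    and distr: "\<And>i. i \<in> {1..k} \<Longrightarrow> distributed M lborel (Z i) (\<lambda>x. ennreal (std_normal_density x))"
    using assms by (auto simp: iid_std_normal_def)
  have Z: "Z i \<in> borel_measurable M" if "i \<in> {1..k}" for i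
    using distributed_measurable[OF distr[OF that]] by simp
  show F: "F \<in> measurable M (\<Pi>\<^sub>M i\<in>{1..k}. borel)"
    unfolding F_def by (rule measurable_restrict) (rule Z)
  interpret N: prob_space N
    unfolding N_def by (rule prob_space_distr[OF F])
  have coord: "(\<lambda>f. f i) \<in> measurable N borel" if "i \<in> {1..k}" for i
    unfolding N_def using that by (simp add: measurable_component_singleton)
  have marginal: "distr N L (\<lambda>f. f i) = distr M L (Z i)"
    if "i \<in> {1..k}" "sets L = sets borel" for i and L :: "real measure"
  proof -
    have "(\<lambda>f. f i) \<in> measurable (\<Pi>\<^sub>M i\<in>{1..k}. borel) L"
      using that by (simp add: measurable_component_singleton cong: measurable_cong_sets)
    from distr_distr[OF this F] show ?thesis
      using that unfolding N_def by (auto simp: F_def intro!: distr_cong)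
  qed
  have "distr N (\<Pi>\<^sub>M i\<in>{1..k}. borel) (\<lambda>f. \<lambda>i\<in>{1..k}. f i) = (\<Pi>\<^sub>M i\<in>{1..k}. distr N borel (\<lambda>f. f i))"
  proof -
    have "distr N (\<Pi>\<^sub>M i\<in>{1..k}. borel) (\<lambda>f. \<lambda>i\<in>{1..k}. f i)
        = distr M (\<Pi>\<^sub>M i\<in>{1..k}. borel) ((\<lambda>f. \<lambda>i\<in>{1..k}. f i) \<circ> F)"
      unfolding N_def by (rule distr_distr[OF _ F]) measurable
    also have "(\<lambda>f. \<lambda>i\<in>{1..k}. f i) \<circ> F = F"
      by (auto simp: F_def fun_eq_iff)
    also have "distr M (\<Pi>\<^sub>M i\<in>{1..k}. borel) F = (\<Pi>\<^sub>M i\<in>{1..k}. distr M borel (Z i))"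
      using indep_vars_iff_distr_eq_PiM'[where I = "{1..k}" and M' = "\<lambda>_. borel" and X = Z] indep Z \<open>k \<noteq> 0\<close>
      unfolding F_def by simp
    also have "\<dots> = (\<Pi>\<^sub>M i\<in>{1..k}. distr N borel (\<lambda>f. f i))"
      by (rule PiM_cong) (simp_all add: marginal)
    finally show ?thesis .
  qed
  then have "N.indep_vars (\<lambda>_. borel) (\<lambda>i f. f i) {1..k}"
    using N.indep_vars_iff_distr_eq_PiM'[where I = "{1..k}" and M' = "\<lambda>_. borel" and X = "\<lambda>i f. f i"] coord \<open>k \<noteq> 0\<close>
    by simp
  moreover have "distributed N lborel (\<lambda>f. f i) (\<lambda>x. ennreal (std_normal_density x))"
    if "i \<in> {1..k}" for i
    using distr[OF that] marginal[OF that, of lborel] coord[OF that]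
    unfolding distributed_def by simp
  ultimately show "iid_std_normal N k (\<lambda>i f. f i)"
    unfolding iid_std_normal_def using N.prob_space_axioms by blast
qed

lemma chi_square_tail_bounds_transfer:
  assumes bounds: "chi_square_tail_bounds TYPE(nat \<Rightarrow> real) c C cbar ctilde Ctilde c1 C1 c2"
  shows "chi_square_tail_bounds TYPE('a) c C cbar ctilde Ctilde c1 C1 c2"
  unfolding chi_square_tail_bounds_def
proof (intro allI impI, goal_cases)
  case (1 k u M Z)
  note u = 1(1,2) and iid = 1(3)
  define F where "F \<omega> = (\<lambda>i\<in>{1..k}. Z i \<omega>)" for \<omega>
  define P where "P = (\<Pi>\<^sub>M i\<in>{1..k}. (borel :: real measure))"
  define N where "N = distr M P F"
  define X' where "X' = centered_weighted_chi_square k u (\<lambda>i f. f i)"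
  have "k \<noteq> 0"
    using u(2) by auto
  note push = iid_std_normal_pushforward[OF iid this, folded F_def[abs_def] P_def, folded N_def]
  have X': "X' \<in> borel_measurable P"
    unfolding X'_def P_def centered_weighted_chi_square_def[abs_def] by measurable
  have X_F: "centered_weighted_chi_square k u Z \<omega> = X' (F \<omega>)" for \<omega>
    by (simp add: X'_def centered_weighted_chi_square_def F_def)
  have event: "measure N {f \<in> space N. X' f \<in> B} = measure M {\<omega> \<in> space M. X' (F \<omega>) \<in> B}"
    if "B \<in> sets borel" for B
  proof -
    have "{f \<in> space P. X' f \<in> B} \<in> sets P"
      using measurable_sets[OF X' that] by (simp add: vimage_def Int_def conj_commute)
    then show ?thesis
      unfolding N_def using measurable_space[OF push(1)]
      by (auto simp: measure_distr[OF push(1)] intro!: arg_cong[where f = "measure M"])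
  qed
  have "measure N {f \<in> space N. x \<le> X' f} = measure M {\<omega> \<in> space M. x \<le> X' (F \<omega>)}"
    "measure N {f \<in> space N. X' f \<le> x} = measure M {\<omega> \<in> space M. X' (F \<omega>) \<le> x}" for x
    using event[of "{x..}"] event[of "{..x}"] by simp_all
  then show ?case
    using bounds[unfolded chi_square_tail_bounds_def, rule_format, OF _ _ push(2), of u] u
    unfolding Let_def X_F X'_def[symmetric] by (simp only:) blast
qed

theorem theorem6:
  shows "(\<exists>c C cbar ctilde Ctilde c1 C1 c2.
            0 < c \<and> 0 < C \<and> 0 < cbar \<and> 0 < ctilde \<and> 0 < Ctilde \<and> 0 < c1 \<and> 0 < C1 \<and> 0 < c2 \<and>
            chi_square_tail_bounds TYPE(nat \<Rightarrow> real) c C cbar ctilde Ctilde c1 C1 c2) \<and>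
         (\<forall>c C cbar ctilde Ctilde c1 C1 c2.
            chi_square_tail_bounds TYPE(nat \<Rightarrow> real) c C cbar ctilde Ctilde c1 C1 c2 \<longrightarrow>
            chi_square_tail_bounds TYPE('a) c C cbar ctilde Ctilde c1 C1 c2)"
proof
  define \<kappa> :: real where "\<kappa> = (1 - exp (- 1 / 1024))\<^sup>2 * exp (- 7 / 128)"
  have "0 < \<kappa>"
    by (simp add: \<kappa>_def)
  then show "\<exists>c C cbar ctilde Ctilde c1 C1 c2.
      0 < c \<and> 0 < C \<and> 0 < cbar \<and> 0 < ctilde \<and> 0 < Ctilde \<and> 0 < c1 \<and> 0 < C1 \<and> 0 < c2 \<and>
      chi_square_tail_bounds TYPE(nat \<Rightarrow> real) c C cbar ctilde Ctilde c1 C1 c2"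
    by (intro exI conjI) (rule_tac [9] chi_square_tail_bounds_explicit[folded \<kappa>_def], simp_all)
next
  show "\<forall>c C cbar ctilde Ctilde c1 C1 c2.
      chi_square_tail_bounds TYPE(nat \<Rightarrow> real) c C cbar ctilde Ctilde c1 C1 c2 \<longrightarrow>
      chi_square_tail_bounds TYPE('a) c C cbar ctilde Ctilde c1 C1 c2"
    using chi_square_tail_bounds_transfer by blast
qed

end
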